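(* Let $x = x_0 + x_1\mathbf{i}+x_2\mathbf{j}+x_3\mathbf{k}$ with $x_0,x_1,x_2,x_3\in\mathbb{R}[t]$ be a reduced rational parametric equation of a rational curve such that $x(\infty) \equiv 1$. Then among all monic motion polynomials $C = P + \varepsilon Q$ such that $C(\infty) = 1$ and the trajectory of the point $1$ is parameterised by $x$, i.e. $$P\overline{P} + 2P\overline{Q} \equiv x,$$ there exists a unique one of minimal degree.
   Context: $\mathbb{H}$ denotes the real quaternions with units $\mathbf{i},\mathbf{j},\mathbf{k}$, and $\mathbb{DH} = \mathbb{H} + \varepsilon\mathbb{H}$ the dual quaternions, where $\varepsilon^2=0$ and $\varepsilon$ commutes with everything. For $h = p + \varepsilon q$ with $p,q\in\mathbb{H}$, the conjugate is $\overline{h} = \overline{p} + \varepsilon \overline{q}$. In $\mathbb{DH}[t]$ and $\mathbb{H}[t]$ the indeterminate $t$ commutes with all coefficients, and conjugation of polynomials is done coefficientwise. A motion polynomial is a polynomial $C = P + \varepsilon Q \in \mathbb{DH}[t]$ with $P,Q\in\mathbb{H}[t]$ whose leading coefficient is invertible (i.e. has non-zero primal part) and such that $C\overline{C}$ has real coefficients, i.e. $P\overline{Q} + Q\overline{P} = 0$. For a polynomial $C$ of degree $n$, $C(\infty)$ denotes its leading coefficient (the coefficient of $t^n$). Points of $\mathbb{P}^3$ are represented by non-zero elements $x_0 + x_1\mathbf{i}+x_2\mathbf{j}+x_3\mathbf{k}$, up to real scalars; the point $1$ is the origin. The trajectory of the point $1$ under $C$ is the rational curve $t\mapsto P\overline{P}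 + 2P\overline{Q}$. The symbol $\equiv$ denotes projective equality, i.e. equality up to multiplication with non-zero real scalars (for points) or non-zero real polynomials (for parametric equations). The parametric equation $x$ is reduced if $\gcd(x_0,x_1,x_2,x_3)$ has degree zero. Its degree is $d=\max_i\deg x_i$, and $x(\infty)$ is the coefficient of $t^d$ in $x$; thus $x(\infty)\equiv 1$ means $\deg x_0 > \deg x_i$ for $i=1,2,3$. *)

theory Defs
  imports Complex_Main "HOL-Computational_Algebra.Computational_Algebra"
    "HOL-Computational_Algebra.Field_as_Ring"
begin

section \<open>Quaternions\<close>

datatype quat = Quat (qre: real) (qi: real) (qj: real) (qk: real)

lemma quat_eq_iff:
  "x = y \<longleftrightarrow> qre x = qre y \<and> qi x = qi y \<and> qj x = qj y \<and> qk x = qk y"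
  by (cases x; cases y) auto

instantiation quat :: real_algebra_1
begin

definition "0 = Quat 0 0 0 0"
definition "1 = Quat 1 0 0 0"
definition "x + y = Quat (qre x + qre y) (qi x + qi y) (qj x + qj y) (qk x + qk y)"
definition "- x = Quat (- qre x) (- qi x) (- qj x) (- qk x)"
definition "x - y = Quat (qre x - qre y) (qi x - qi y) (qj x - qj y) (qk x - qk y)"
definition "c *\<^sub>R x = Quat (c * qre x) (c * qi x) (c * qj x) (c * qk x)"
definition "x * y = Quat
  (qre x * qre y - qi x * qi y - qj x * qj y - qk x * qk y)
  (qre x * qi y + qi x * qre y + qj x * qk y - qk x * qj y)
  (qre x * qj y - qi x * qk y + qj x * qre y + qk x * qi y)
  (qre x * qk y + qi x * qj y - qj x * qi y + qk x * qre y)"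

lemmas quat_ops = zero_quat_def one_quat_def plus_quat_def uminus_quat_def
  minus_quat_def scaleR_quat_def times_quat_def

instance
  by standard (simp_all add: quat_ops algebra_simps)

end

definition quat_i :: quat where "quat_i = Quat 0 1 0 0"
definition quat_j :: quat where "quat_j = Quat 0 0 1 0"
definition quat_k :: quat where "quat_k = Quat 0 0 0 1"

lemma quat_units:
  "quat_i * quat_i = - 1" "quat_j * quat_j = - 1" "quat_k * quat_k = - 1"
  "quat_i * quat_j = quat_k" "quat_j * quat_k = quat_i" "quat_k * quat_i = quat_j"
  by (simp_all add: quat_ops quat_i_def quat_j_def quat_k_def)

definition qcnj :: "quat \<Rightarrow> quat" where
  "qcnj x = Quat (qre x) (- qi x) (- qj x) (- qk x)"


section \<open>Dual quaternions\<close>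

text \<open>\<open>DQuat p q\<close> stands for \<open>p + \<epsilon> q\<close>.\<close>

datatype dquat = DQuat (primal: quat) (dual: quat)

lemma dquat_eq_iff: "x = y \<longleftrightarrow> primal x = primal y \<and> dual x = dual y"
  by (cases x; cases y) auto

instantiation dquat :: real_algebra_1
begin

definition "0 = DQuat 0 0"
definition "1 = DQuat 1 0"
definition "x + y = DQuat (primal x + primal y) (dual x + dual y)"
definition "- x = DQuat (- primal x) (- dual x)"
definition "x - y = DQuat (primal x - primal y) (dual x - dual y)"
definition "c *\<^sub>R x = DQuat (c *\<^sub>R primal x) (c *\<^sub>R dual x)"
definition "x * y = DQuat (primal x * primal y) (primal x * dual y + dual x * primal y)"

lemmas dquat_ops = zero_dquat_def one_dquat_def plus_dquat_def uminus_dquat_def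
  minus_dquat_def scaleR_dquat_def times_dquat_def

instance
  by standard (simp_all add: dquat_ops algebra_simps)

end

definition dqcnj :: "dquat \<Rightarrow> dquat" where
  "dqcnj h = DQuat (qcnj (primal h)) (qcnj (dual h))"


lemma dquat_invertible_iff:
  "(\<exists>u. h * u = 1 \<and> u * h = 1) \<longleftrightarrow> primal h \<noteq> 0" for h :: dquat
proof
  assume "\<exists>u. h * u = 1 \<and> u * h = 1"
  then show "primal h \<noteq> 0"
    by (auto simp: dquat_ops quat_ops)
next
  assume nz: "primal h \<noteq> 0"
  define p where "p = primal h"
  define n where "n = (qre p)\<^sup>2 + (qi p)\<^sup>2 + (qj p)\<^sup>2 + (qk p)\<^sup>2"
  define v where "v = inverse n *\<^sub>R qcnj p"
  have "n \<noteq> 0"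
    using nz by (auto simp: n_def p_def zero_quat_def quat_eq_iff add_nonneg_eq_0_iff)
  have "p * qcnj p = n *\<^sub>R 1" "qcnj p * p = n *\<^sub>R 1"
    by (simp_all add: quat_ops qcnj_def n_def power2_eq_square)
  then have pv: "p * v = 1" and vp: "v * p = 1"
    using \<open>n \<noteq> 0\<close> by (simp_all add: v_def)
  have "h * DQuat v (- (v * dual h * v)) = 1"
    by (simp add: dquat_ops pv mult.assoc[symmetric] flip: p_def)
  moreover have "DQuat v (- (v * dual h * v)) * h = 1"
    by (simp add: dquat_ops vp mult.assoc flip: p_def)
  ultimately show "\<exists>u. h * u = 1 \<and> u * h = 1" by blast
qed


section \<open>Polynomials with a central indeterminate\<close>

text \<open>
  The product \<open>*\<close> on \<^typ>\<open>'a poly\<close> is only available for commutative coefficients, so the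
  product over a general coefficient ring, with \<open>t\<close> commuting with the coefficients, is defined here.
\<close>

definition pmult :: "'a::semiring_0 poly \<Rightarrow> 'a poly \<Rightarrow> 'a poly"  (infixl "\<star>" 70) where
  "p \<star> q = (\<Sum>i\<le>degree p. \<Sum>j\<le>degree q. monom (coeff p i * coeff q j) (i + j))"

lemma coeff_pmult: "coeff (p \<star> q) n = (\<Sum>i\<le>n. coeff p i * coeff q (n - i))"
proof -
  have inner: "(\<Sum>j\<le>degree q. coeff (monom (coeff p i * coeff q j) (i + j)) n) =
      (if i \<le> n then coeff p i * coeff q (n - i) else 0)" for i
  proof (cases "i \<le> n")
    case True
    have "(\<Sum>j\<le>degree q. coeff (monom (coeff p i * coeff q j) (i + j)) n) =
        (\<Sum>j\<le>degree q. if j = n - i then coeff p i * coeff q (n - i) else 0)"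
      using True by (intro sum.cong) auto
    also have "\<dots> = coeff p i * coeff q (n - i)"
      by (simp add: sum.delta coeff_eq_0)
    finally show ?thesis using True by simp
  next
    case False
    then show ?thesis by (auto intro!: sum.neutral)
  qed
  have "coeff (p \<star> q) n =
      (\<Sum>i\<le>degree p. if i \<le> n then coeff p i * coeff q (n - i) else 0)"
    unfolding pmult_def coeff_sum inner ..
  also have "\<dots> = (\<Sum>i\<in>{..degree p} \<inter> {..n}. coeff p i * coeff q (n - i))"
    by (simp only: sum.inter_restrict[OF finite_atMost] atMost_iff)
  also have "\<dots> = (\<Sum>i\<le>n. coeff p i * coeff q (n - i))"
    by (rule sum.mono_neutral_left) (auto intro!: le_degree)
  finally show ?thesis .
qed

lemma pmult_commutative: "p \<star> q = p * q" for p q :: "'a::comm_semiring_0 poly"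
  by (simp add: poly_eq_iff coeff_pmult coeff_mult)

definition real_coeffs :: "'a::real_algebra_1 poly \<Rightarrow> bool" where
  "real_coeffs p \<longleftrightarrow> (\<forall>n. coeff p n \<in> \<real>)"

definition quat_poly :: "real poly \<Rightarrow> real poly \<Rightarrow> real poly \<Rightarrow> real poly \<Rightarrow> quat poly" where
  "quat_poly x0 x1 x2 x3 =
     map_poly of_real x0 + map_poly of_real x1 \<star> [:quat_i:] +
     map_poly of_real x2 \<star> [:quat_j:] + map_poly of_real x3 \<star> [:quat_k:]"

lemma of_real_quat: "of_real r = Quat r 0 0 0"
  by (simp add: of_real_def quat_ops)

lemma coeff_pmult_const: "coeff (p \<star> [:c:]) n = coeff p n * c"
proof -
  have "coeff (p \<star> [:c:]) n = (\<Sum>i\<le>n. if i = n then coeff p n * c else 0)"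
    unfolding coeff_pmult by (intro sum.cong) (auto simp: coeff_pCons split: nat.split)
  then show ?thesis by simp
qed

lemma coeff_quat_poly:
  "coeff (quat_poly x0 x1 x2 x3) n = Quat (coeff x0 n) (coeff x1 n) (coeff x2 n) (coeff x3 n)"
  by (simp add: quat_poly_def coeff_pmult_const coeff_map_poly of_real_quat
      quat_ops quat_i_def quat_j_def quat_k_def)

text \<open>
  Hence the degree of a curve, the maximum of the degrees of its components, is the library degree
  of the quaternion polynomial, and its value at infinity is the leading coefficient.
\<close>

lemma degree_quat_poly:
  "degree (quat_poly x0 x1 x2 x3) = Max {degree x0, degree x1, degree x2, degree x3}"
    (is "?l = Max ?D")
proof (rule antisym)
  show "?l \<le> Max ?D"
  proof (rule degree_le, intro allI impI)
    fix i assume "Max ?D < i"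
    then show "coeff (quat_poly x0 x1 x2 x3) i = 0"
      by (simp add: coeff_quat_poly coeff_eq_0 zero_quat_def)
  qed
  have "degree x0 \<le> ?l \<and> degree x1 \<le> ?l \<and> degree x2 \<le> ?l \<and> degree x3 \<le> ?l"
    by (intro conjI degree_le allI impI;
        drule coeff_eq_0; simp add: coeff_quat_poly zero_quat_def)
  then show "Max ?D \<le> ?l" by simp
qed


section \<open>Projective equality\<close>

definition point_equiv :: "quat \<Rightarrow> quat \<Rightarrow> bool" where
  "point_equiv x y \<longleftrightarrow> (\<exists>c::real. c \<noteq> 0 \<and> x = c *\<^sub>R y)"

definition curve_equiv :: "quat poly \<Rightarrow> quat poly \<Rightarrow> bool" where
  "curve_equiv x y \<longleftrightarrow> (\<exists>a b::real poly. a \<noteq> 0 \<and> b \<noteq> 0 \<and>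
     map_poly of_real a \<star> x = map_poly of_real b \<star> y)"


section \<open>Motion polynomials\<close>

definition motion_polynomial :: "dquat poly \<Rightarrow> bool" where
  "motion_polynomial C \<longleftrightarrow>
     (\<exists>u. lead_coeff C * u = 1 \<and> u * lead_coeff C = 1) \<and>
     real_coeffs (C \<star> map_poly dqcnj C)"

text \<open>The trajectory of the origin under \<open>C = P + \<epsilon> Q\<close>.\<close>

definition origin_trajectory :: "dquat poly \<Rightarrow> quat poly" where
  "origin_trajectory C =
     (let P = map_poly primal C; Q = map_poly dual C
      in P \<star> map_poly qcnj P + [:2:] \<star> P \<star> map_poly qcnj Q)"

end

theory Submission
  imports Defs
begin

text \<open>
  Write \<open>x = x\<^sub>0 + V\<close> with \<open>V\<close> the vector part, and \<open>C = P + \<epsilon> Q\<close>. For a motion polynomial \<open>C\<close>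
  the product of \<open>P\<close> with the conjugate of \<open>Q\<close> is a pure vector, so comparing scalar and vector
  parts of the trajectory with \<open>x\<close>, up to real polynomial factors, and cancelling a nonzero factor
  turns the quadratic trajectory condition into the equation \<open>2 x\<^sub>0 Q + V P = 0\<close>. Conversely, this
  equation forces both the motion polynomial condition and the trajectory. This equivalence, for
  \<open>C\<close> with leading coefficient 1, is \<open>trajectory_iff\<close>.

  The equation is linear in \<open>C\<close> and invariant under multiplication by quaternions from the right.
  Moreover \<open>V\<close> is zero or \<open>deg V < deg x\<^sub>0\<close> by the condition at infinity, so every solution has
  \<open>Q = 0\<close> or \<open>deg Q < deg P\<close>. The leading coefficient of a nonzero solution is therefore a nonzero
  quaternion, and the solution can be made monic (\<open>monic_multiple\<close>). If two monic solutions of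
  minimal degree were different, their difference would be a nonzero solution of smaller degree, and
  making it monic would contradict minimality (\<open>ex1_monic_min_degree\<close>). Solutions exist:
  \<open>P = 2 x\<^sub>0\<close> and \<open>Q = - V\<close> give one.

  The polynomial \<open>2 Q\<close> is written \<open>Q + Q\<close> throughout.
\<close>

section \<open>Quaternions form a domain with conjugation\<close>

lemma quat_right_inverse:
  fixes p :: quat
  assumes "p \<noteq> 0"
  obtains v where "p * v = 1" "v * p = 1"
proof -
  obtain u where "DQuat p 0 * u = 1 \<and> u * DQuat p 0 = 1"
    using assms dquat_invertible_iff[of "DQuat p 0"] by auto
  then have "p * primal u = 1" "primal u * p = 1"
    by (auto simp: dquat_ops)
  then show thesis by (rule that)
qed

instance quat :: ring_no_zero_divisors
proof
  fix a b :: quat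
  assume "a \<noteq> 0" "b \<noteq> 0"
  obtain v where v: "v * a = 1"
    using quat_right_inverse[OF \<open>a \<noteq> 0\<close>] by blast
  have "v * (a * b) = b"
    by (simp add: v flip: mult.assoc)
  with \<open>b \<noteq> 0\<close> show "a * b \<noteq> 0" by auto
qed

lemma qcnj_simps [simp]:
  "qcnj 0 = 0" "qcnj (x + y) = qcnj x + qcnj y" "qcnj (- x) = - qcnj x"
  "qcnj (qcnj x) = x" "qcnj (of_real r) = of_real r"
  by (simp_all add: qcnj_def quat_ops of_real_quat)

lemma qcnj_mult: "qcnj (x * y) = qcnj y * qcnj x"
  by (simp add: qcnj_def quat_ops)

lemma qcnj_sum: "qcnj (sum f A) = (\<Sum>x\<in>A. qcnj (f x))"
  by (induction A rule: infinite_finite_induct) simp_all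

lemma qcnj_eq_self_iff: "qcnj x = x \<longleftrightarrow> x = of_real (qre x)"
  by (auto simp: qcnj_def of_real_quat quat_eq_iff)


section \<open>Polynomials with noncommuting coefficients as formal power series\<close>

text \<open>
  Formal power series over an arbitrary ring form a ring, and over a ring without zero divisors a
  ring without zero divisors. Identities for \<open>\<star>\<close> are therefore proved by passing to power series.
\<close>

lemma fps_of_poly_pmult: "fps_of_poly (p \<star> q) = fps_of_poly p * fps_of_poly q"
  by (simp add: fps_eq_iff fps_mult_nth coeff_pmult atLeast0AtMost)

lemmas fps_of_poly_hom = fps_of_poly_pmult fps_of_poly_add fps_of_poly_uminus fps_of_poly_diff

lemma fps_of_poly_eq_0_iff: "fps_of_poly p = 0 \<longleftrightarrow> p = 0"
  by (metis fps_of_poly_0 fps_of_poly_eq_iff)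

lemma pmult_eq_0_iff:
  fixes p q :: "'a::ring_no_zero_divisors poly"
  shows "p \<star> q = 0 \<longleftrightarrow> p = 0 \<or> q = 0"
  by (metis fps_of_poly_eq_0_iff fps_of_poly_pmult mult_eq_0_iff)

lemma degree_pmult:
  fixes p q :: "'a::semiring_no_zero_divisors poly"
  assumes "p \<noteq> 0" "q \<noteq> 0"
  shows "degree (p \<star> q) = degree p + degree q"
proof (rule antisym)
  show "degree (p \<star> q) \<le> degree p + degree q"
  proof (rule degree_le, intro allI impI)
    fix n assume n: "degree p + degree q < n"
    have "coeff p i * coeff q (n - i) = 0" for i
    proof (cases "degree p < i")
      case True
      then show ?thesis by (simp add: coeff_eq_0)
    next
      case False
      with n have "degree q < n - i" by linarith
      then show ?thesis by (simp add: coeff_eq_0)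
    qed
    then show "coeff (p \<star> q) n = 0"
      unfolding coeff_pmult by (intro sum.neutral ballI)
  qed
  let ?n = "degree p + degree q"
  have "coeff (p \<star> q) ?n = (\<Sum>i\<le>?n. if i = degree p then lead_coeff p * lead_coeff q else 0)"
    unfolding coeff_pmult
  proof (intro sum.cong refl)
    fix i assume "i \<in> {..?n}"
    show "coeff p i * coeff q (?n - i) =
        (if i = degree p then lead_coeff p * lead_coeff q else 0)"
    proof (cases i "degree p" rule: linorder_cases)
      case less
      then have "degree q < ?n - i" by linarith
      with less show ?thesis by (simp add: coeff_eq_0)
    qed (simp_all add: coeff_eq_0)
  qed
  also have "\<dots> = lead_coeff p * lead_coeff q" by simp
  finally show "?n \<le> degree (p \<star> q)"
    using assms by (intro le_degree) simp
qed

lemma fps_of_real_poly_central: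
  fixes f :: "'a::real_algebra_1 fps"
  shows "fps_of_poly (map_poly of_real a) * f = f * fps_of_poly (map_poly of_real a)"
proof (rule fps_ext)
  fix n
  have "fps_nth (fps_of_poly (map_poly of_real a) * f) n
      = (\<Sum>i=0..n. fps_nth f (n - i) * of_real (coeff a i))"
    by (simp add: fps_mult_nth coeff_map_poly of_real_def)
  also have "\<dots> = (\<Sum>i=0..n. fps_nth f i * of_real (coeff a (n - i)))"
    by (rule sum.reindex_bij_witness[of _ "\<lambda>i. n - i" "\<lambda>i. n - i"]) auto
  finally show "fps_nth (fps_of_poly (map_poly of_real a) * f) n
      = fps_nth (f * fps_of_poly (map_poly of_real a)) n"
    by (simp add: fps_mult_nth coeff_map_poly)
qed

lemma of_real_poly_eq_0_iff:
  "map_poly of_real a = (0 :: 'a::real_algebra_1 poly) \<longleftrightarrow> a = 0"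
  by (simp add: map_poly_eq_0_iff)

abbreviation qcnj_poly :: "quat poly \<Rightarrow> quat poly" where
  "qcnj_poly \<equiv> map_poly qcnj"

lemma coeff_qcnj_poly [simp]: "coeff (qcnj_poly p) n = qcnj (coeff p n)"
  by (simp add: coeff_map_poly)

lemma qcnj_poly_simps [simp]:
  "qcnj_poly (p + q) = qcnj_poly p + qcnj_poly q" "qcnj_poly (- p) = - qcnj_poly p"
  "qcnj_poly (qcnj_poly p) = p" "qcnj_poly (map_poly of_real a) = map_poly of_real a"
  by (simp_all add: poly_eq_iff coeff_map_poly)

lemma qcnj_poly_pmult: "qcnj_poly (p \<star> q) = qcnj_poly q \<star> qcnj_poly p"
proof (rule poly_eqI)
  fix n
  have "(\<Sum>i\<le>n. qcnj (coeff q (n - i)) * qcnj (coeff p i))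
      = (\<Sum>i\<le>n. qcnj (coeff q i) * qcnj (coeff p (n - i)))"
    by (rule sum.reindex_bij_witness[of _ "\<lambda>i. n - i" "\<lambda>i. n - i"]) auto
  then show "coeff (qcnj_poly (p \<star> q)) n = coeff (qcnj_poly q \<star> qcnj_poly p) n"
    by (simp add: coeff_pmult qcnj_sum qcnj_mult)
qed

text \<open>
  Conjugation reverses products, so the norm polynomial is its own conjugate; a quaternion fixed by
  conjugation is real.
\<close>

lemma norm_poly_real: "p \<star> qcnj_poly p = map_poly of_real (map_poly qre (p \<star> qcnj_poly p))"
proof (rule poly_eqI)
  fix n
  have "qcnj_poly (p \<star> qcnj_poly p) = p \<star> qcnj_poly p"
    by (simp add: qcnj_poly_pmult)
  then have "qcnj (coeff (p \<star> qcnj_poly p) n) = coeff (p \<star> qcnj_poly p) n"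
    by (metis coeff_qcnj_poly)
  then show "coeff (p \<star> qcnj_poly p) n
      = coeff (map_poly of_real (map_poly qre (p \<star> qcnj_poly p))) n"
    by (simp add: qcnj_eq_self_iff coeff_map_poly zero_quat_def)
qed


section \<open>Motion polynomials with a given trajectory\<close>

abbreviation primal_poly :: "dquat poly \<Rightarrow> quat poly" where
  "primal_poly \<equiv> map_poly primal"

abbreviation dual_poly :: "dquat poly \<Rightarrow> quat poly" where
  "dual_poly \<equiv> map_poly dual"

lemma dquat_proj_simps [simp]:
  "primal 0 = 0" "dual 0 = 0" "primal 1 = 1" "dual 1 = 0"
  "primal (x + y) = primal x + primal y" "dual (x + y) = dual x + dual y"
  "primal (x - y) = primal x - primal y" "dual (x - y) = dual x - dual y"
  "primal (x * y) = primal x * primal y" "dual (x * y) = primal x * dual y + dual x * primal y"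
  by (simp_all add: dquat_ops)

lemma dquat_proj_sum:
  "primal (sum f A) = (\<Sum>x\<in>A. primal (f x))" "dual (sum f A) = (\<Sum>x\<in>A. dual (f x))"
  by (induction A rule: infinite_finite_induct; simp)+

lemma coeff_dquat_proj [simp]:
  "coeff (primal_poly C) n = primal (coeff C n)" "coeff (dual_poly C) n = dual (coeff C n)"
  by (simp_all add: coeff_map_poly)

lemma dquat_real_iff: "h \<in> \<real> \<longleftrightarrow> primal h \<in> \<real> \<and> dual h = 0" for h :: dquat
  by (cases h) (auto simp: Reals_def of_real_def dquat_ops)

text \<open>
  The primal part of the product of \<open>C\<close> with its conjugate is the norm polynomial of \<open>P\<close>, which is
  always real. Only the vanishing of the dual part is a condition.
\<close>

lemma motion_polynomial_iff:
  assumes "lead_coeff C = 1"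
  shows "motion_polynomial C \<longleftrightarrow>
    primal_poly C \<star> qcnj_poly (dual_poly C) + dual_poly C \<star> qcnj_poly (primal_poly C) = 0"
    (is "_ \<longleftrightarrow> ?D = 0")
proof -
  have cnj: "coeff (map_poly dqcnj C) n = dqcnj (coeff C n)" for n
    by (rule coeff_map_poly) (simp add: dqcnj_def dquat_ops)
  let ?P = "primal_poly C"
  have "primal (coeff (C \<star> map_poly dqcnj C) n) = coeff (?P \<star> qcnj_poly ?P) n" for n
    by (simp add: coeff_pmult dquat_proj_sum cnj dqcnj_def)
  moreover have "coeff (?P \<star> qcnj_poly ?P) n \<in> \<real>" for n
    by (subst norm_poly_real) (simp add: coeff_map_poly)
  moreover have "dual (coeff (C \<star> map_poly dqcnj C) n) = coeff ?D n" for n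
    by (simp add: coeff_pmult dquat_proj_sum cnj dqcnj_def sum.distrib)
  ultimately have "real_coeffs (C \<star> map_poly dqcnj C) \<longleftrightarrow> ?D = 0"
    by (simp add: real_coeffs_def dquat_real_iff poly_eq_iff)
  moreover have "\<exists>u. lead_coeff C * u = 1 \<and> u * lead_coeff C = 1"
    using assms by (intro exI[of _ 1]) simp
  ultimately show ?thesis by (simp add: motion_polynomial_def)
qed

text \<open>
  The step in which the trajectory condition becomes linear: multiplying the vector part by \<open>x\<close>
  and replacing \<open>b * x\<close> by means of the scalar part leaves \<open>a\<close> and \<open>p'\<close> as common factors.
  Here \<open>p'\<close> stands for the conjugate of \<open>p\<close>, and \<open>q\<close> for \<open>2 Q\<close>.
\<close>

lemma ring_cancel_trajectory:
  fixes a b n x p p' q v :: "'a::ring_no_zero_divisors"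
  assumes central: "\<And>y. a * y = y * a" "\<And>y. b * y = y * b" "\<And>y. x * y = y * x"
    and nz: "a \<noteq> 0" "p' \<noteq> 0"
    and scalar: "a * (p * p') = b * x"
    and vector: "a * (q * p') = - (b * v)"
  shows "x * q + v * p = 0"
proof -
  have "a * ((x * q + v * p) * p') = x * (a * (q * p')) + v * (a * (p * p'))"
    by (metis (no_types, lifting) central(1) distrib_left distrib_right mult.assoc)
  also have "\<dots> = 0"
    unfolding scalar vector by (metis add.left_inverse central(2,3) mult.assoc mult_minus_right)
  finally show ?thesis using nz by simp
qed

text \<open>
  The hypothesis on \<open>V\<close> says that it is a pure vector. From left to right, the scalar and vector
  parts of the trajectory equation are separated by adding and subtracting its conjugate. From right
  to left, the trajectory times \<open>x\<^sub>0\<close> equals \<open>x\<^sub>0 + V\<close> times the norm polynomial of \<open>P\<close>.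
\<close>

lemma trajectory_iff:
  fixes C :: "dquat poly" and x0 :: "real poly" and V :: "quat poly"
  defines "X0 \<equiv> map_poly of_real x0"
  assumes lead: "lead_coeff C = 1" and "x0 \<noteq> 0" and V: "qcnj_poly V = - V"
  shows "motion_polynomial C \<and> curve_equiv (origin_trajectory C) (X0 + V) \<longleftrightarrow>
    X0 \<star> (dual_poly C + dual_poly C) + V \<star> primal_poly C = 0"
proof -
  let ?R = "\<lambda>a. map_poly of_real a :: quat poly" and ?f = "fps_of_poly :: quat poly \<Rightarrow> quat fps"
  define P Q where "P = primal_poly C" and "Q = dual_poly C + dual_poly C"
  have X0: "?f X0 \<noteq> 0" "qcnj_poly X0 = X0"
    using \<open>x0 \<noteq> 0\<close> by (simp_all add: X0_def fps_of_poly_eq_0_iff of_real_poly_eq_0_iff)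
  have "coeff P (degree C) = 1" using lead by (simp add: P_def)
  then have P: "P \<noteq> 0" "qcnj_poly P \<noteq> 0"
    by (metis coeff_0 zero_neq_one)
      (metis \<open>coeff P (degree C) = 1\<close> coeff_0 coeff_qcnj_poly qcnj_simps(1,4) zero_neq_one)
  define n where "n = map_poly qre (P \<star> qcnj_poly P)"
  have n: "P \<star> qcnj_poly P = ?R n"
    unfolding n_def by (rule norm_poly_real)
  have fn: "?f P * ?f (qcnj_poly P) = ?f (?R n)"
    by (simp flip: n fps_of_poly_pmult)
  have "?f (?R n) \<noteq> 0"
    using P by (simp flip: fn add: fps_of_poly_eq_0_iff)
  then have "n \<noteq> 0" by auto
  have traj: "origin_trajectory C = P \<star> qcnj_poly P + P \<star> qcnj_poly Q"
  proof -
    have "[:2:] \<star> P = P + P"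
      by (simp add: fps_of_poly_hom mult_2 flip: fps_of_poly_eq_iff)
    then show ?thesis
      by (simp add: origin_trajectory_def Let_def P_def Q_def algebra_simps fps_of_poly_hom
          flip: fps_of_poly_eq_iff)
  qed
  have motion: "motion_polynomial C \<longleftrightarrow> P \<star> qcnj_poly Q + Q \<star> qcnj_poly P = 0" (is "_ \<longleftrightarrow> ?M Q = 0")
  proof -
    have "?M Q = ?M (dual_poly C) + ?M (dual_poly C)"
      by (simp add: Q_def P_def algebra_simps fps_of_poly_hom flip: fps_of_poly_eq_iff)
    moreover have "q + q = 0 \<longleftrightarrow> q = 0" for q :: "quat poly"
      by (auto simp: poly_eq_iff quat_eq_iff quat_ops)
    ultimately show ?thesis by (simp add: motion_polynomial_iff[OF lead] P_def)
  qed
  have "X0 \<star> Q + V \<star> P = 0"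
    if M: "?M Q = 0" and ab: "a \<noteq> 0" "?R a \<star> (P \<star> qcnj_poly P + P \<star> qcnj_poly Q) = ?R b \<star> (X0 + V)"
    for a b
  proof -
    have M': "?f P * ?f (qcnj_poly Q) = - (?f Q * ?f (qcnj_poly P))"
      using M by (simp add: fps_of_poly_hom eq_neg_iff_add_eq_0 flip: fps_of_poly_eq_iff)
    have two: "p = q" if "p + p = q + q" for p q :: "quat fps"
      using that by (auto simp: fps_eq_iff quat_eq_iff quat_ops)
    \<comment> \<open>The trajectory equation and its conjugate.\<close>
    have e1: "?f (?R a) * (?f P * ?f (qcnj_poly P) - ?f Q * ?f (qcnj_poly P)) = ?f (?R b) * (?f X0 + ?f V)"
      using arg_cong[OF ab(2), of ?f] by (simp add: fps_of_poly_hom M')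
    have e2: "?f (?R a) * (?f P * ?f (qcnj_poly P) + ?f Q * ?f (qcnj_poly P)) = ?f (?R b) * (?f X0 - ?f V)"
      using arg_cong[OF ab(2), of "\<lambda>p. ?f (qcnj_poly p)"]
      by (simp add: fps_of_poly_hom qcnj_poly_pmult V X0 fps_of_real_poly_central)
    have "?f X0 * ?f Q + ?f V * ?f P = 0"
    proof (rule ring_cancel_trajectory)
      show "?f (?R a) * (?f P * ?f (qcnj_poly P)) = ?f (?R b) * ?f X0"
        by (rule two) (use arg_cong2[OF e1 e2, of "(+)"] in \<open>simp add: algebra_simps\<close>)
      show "?f (?R a) * (?f Q * ?f (qcnj_poly P)) = - (?f (?R b) * ?f V)"
        by (rule two) (use arg_cong2[OF e2 e1, of "(-)"] in \<open>simp add: algebra_simps\<close>)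
    qed (use P ab in \<open>simp_all add: X0_def fps_of_real_poly_central fps_of_poly_eq_0_iff of_real_poly_eq_0_iff\<close>)
    then show ?thesis by (simp add: fps_of_poly_hom flip: fps_of_poly_eq_iff)
  qed
  moreover have "?M Q = 0 \<and> ?R x0 \<star> (P \<star> qcnj_poly P + P \<star> qcnj_poly Q) = ?R n \<star> (X0 + V)"
    if E: "X0 \<star> Q + V \<star> P = 0"
  proof -
    have Q: "?f X0 * ?f Q = - (?f V * ?f P)"
      using E by (simp add: fps_of_poly_hom eq_neg_iff_add_eq_0 flip: fps_of_poly_eq_iff)
    have "X0 \<star> Q = - (V \<star> P)"
      using E by (simp add: eq_neg_iff_add_eq_0)
    from arg_cong[OF this, of qcnj_poly] have "?f (qcnj_poly Q) * ?f X0 = ?f (qcnj_poly P) * ?f V"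
      by (simp add: qcnj_poly_pmult X0 V fps_of_poly_hom flip: fps_of_poly_eq_iff)
    \<comment> \<open>Both summands of the motion condition become multiples of \<open>V\<close>, since \<open>x\<^sub>0\<close> and the norm
      polynomial \<open>n\<close> commute with everything; they cancel.\<close>
    then have PQ: "?f X0 * (?f P * ?f (qcnj_poly Q)) = ?f (?R n) * ?f V"
      by (metis X0_def fn fps_of_real_poly_central mult.assoc)
    have QP: "?f X0 * (?f Q * ?f (qcnj_poly P)) = - (?f (?R n) * ?f V)"
      by (metis Q fn fps_of_real_poly_central mult.assoc mult_minus_left)
    have "?f X0 * ?f (?M Q) = 0"
      by (simp add: fps_of_poly_hom distrib_left PQ QP)
    with X0 have "?M Q = 0" by (simp add: fps_of_poly_eq_0_iff)
    moreover have "?R x0 \<star> (P \<star> qcnj_poly P + P \<star> qcnj_poly Q) = ?R n \<star> (X0 + V)"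
      unfolding X0_def[symmetric]
      by (simp add: fps_of_poly_hom distrib_left PQ fn fps_of_real_poly_central[of n]
          flip: fps_of_poly_eq_iff)
    ultimately show ?thesis ..
  qed
  ultimately show ?thesis
    unfolding motion traj curve_equiv_def P_def[symmetric] Q_def[symmetric]
    using \<open>n \<noteq> 0\<close> \<open>x0 \<noteq> 0\<close> by blast
qed


section \<open>The motion polynomial of minimal degree\<close>

text \<open>
  Degrees add in products, so the products \<open>X0 \<star> (Q + Q)\<close> and \<open>V \<star> P\<close> can only have equal degrees
  if \<open>Q\<close> makes up for the larger degree of \<open>X0\<close>.
\<close>

lemma dual_degree_less:
  fixes X0 V P Q :: "quat poly"
  assumes eq: "X0 \<star> (Q + Q) + V \<star> P = 0" and "V \<noteq> 0 \<Longrightarrow> degree V < degree X0"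
    and "X0 \<noteq> 0" "Q \<noteq> 0"
  shows "P \<noteq> 0 \<and> degree Q < degree P"
proof -
  have coeff: "coeff (Q + Q) i = 0 \<longleftrightarrow> coeff Q i = 0" for i
    by (simp add: quat_eq_iff quat_ops)
  then have "Q + Q \<noteq> 0" using \<open>Q \<noteq> 0\<close> by (metis coeff_0 poly_eqI)
  have deg: "degree Q \<le> degree (Q + Q)"
    using coeff \<open>Q \<noteq> 0\<close> by (intro le_degree) simp
  have eq': "X0 \<star> (Q + Q) = - (V \<star> P)" using eq by (simp add: eq_neg_iff_add_eq_0)
  have "X0 \<star> (Q + Q) \<noteq> 0"
    using \<open>X0 \<noteq> 0\<close> \<open>Q + Q \<noteq> 0\<close>
    by (simp add: pmult_eq_0_iff)
  then have "V \<star> P \<noteq> 0" using eq' by auto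
  then have "V \<noteq> 0" "P \<noteq> 0"
    by (auto simp: pmult_eq_0_iff)
  have "degree X0 + degree (Q + Q) = degree V + degree P"
    using arg_cong[OF eq', of degree] \<open>X0 \<noteq> 0\<close> \<open>Q + Q \<noteq> 0\<close> \<open>V \<noteq> 0\<close> \<open>P \<noteq> 0\<close>
    by (simp add: degree_pmult)
  with deg assms(2)[OF \<open>V \<noteq> 0\<close>] \<open>P \<noteq> 0\<close> show ?thesis by simp
qed

text \<open>
  Dual quaternions without primal part are not invertible, so a nonzero polynomial need not have an
  invertible leading coefficient. But the dual part of a solution vanishes or has smaller degree
  than its primal part, hence the leading coefficient is a nonzero quaternion, which can be divided
  out on the right.
\<close>

lemma monic_multiple:
  fixes X0 V :: "quat poly" and C :: "dquat poly"
  assumes eq: "X0 \<star> (dual_poly C + dual_poly C) + V \<star> primal_poly C = 0"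
    and V: "V \<noteq> 0 \<Longrightarrow> degree V < degree X0" and "X0 \<noteq> 0" "C \<noteq> 0"
  obtains E where "X0 \<star> (dual_poly E + dual_poly E) + V \<star> primal_poly E = 0"
    "lead_coeff E = 1" "degree E \<le> degree C"
proof -
  let ?P = "primal_poly C" and ?Q = "dual_poly C"
  have "dual (lead_coeff C) = 0"
  proof (rule ccontr)
    assume nz: "dual (lead_coeff C) \<noteq> 0"
    then have "coeff ?Q (degree C) \<noteq> 0" by simp
    then have "degree C \<le> degree ?Q" "?Q \<noteq> 0"
      using le_degree by (blast, metis coeff_0)
    then have "degree C < degree ?P"
      using dual_degree_less[OF eq V \<open>X0 \<noteq> 0\<close>] by simp
    then show False
      using map_poly_degree_leq[of primal C] by simp
  qed
  with \<open>C \<noteq> 0\<close> have "primal (lead_coeff C) \<noteq> 0"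
    by (metis dquat_eq_iff dquat_proj_simps(1,2) leading_coeff_0_iff)
  then obtain v where v: "primal (lead_coeff C) * v = 1"
    using quat_right_inverse by blast
  \<comment> \<open>The factor must be free of \<open>\<epsilon>\<close>: the equation is not invariant under dual quaternion factors.\<close>
  define E where "E = C \<star> [:DQuat v 0:]"
  have E: "coeff E i = coeff C i * DQuat v 0" for i
    by (simp add: E_def coeff_pmult_const)
  have proj: "primal_poly E = ?P \<star> [:v:]" "dual_poly E = ?Q \<star> [:v:]"
    by (simp_all add: poly_eq_iff E coeff_pmult_const)
  have "coeff E (degree C) = 1"
    using v \<open>dual (lead_coeff C) = 0\<close> by (simp add: E dquat_eq_iff)
  moreover have "degree E \<le> degree C"
    by (rule degree_le) (simp add: E coeff_eq_0)
  moreover from calculation have "degree E = degree C"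
    by (metis le_antisym le_degree zero_neq_one)
  moreover have "X0 \<star> (dual_poly E + dual_poly E) + V \<star> primal_poly E
      = (X0 \<star> (?Q + ?Q) + V \<star> ?P) \<star> [:v:]"
    by (simp add: proj fps_of_poly_hom algebra_simps flip: fps_of_poly_eq_iff)
  ultimately show thesis
    using that[of E] eq by (simp add: fps_of_poly_hom flip: fps_of_poly_eq_iff)
qed

text \<open>
  The argument that shows that a nonzero right ideal of a polynomial ring over a skew field has a
  unique monic generator, applied to the solution space.
\<close>

lemma ex1_monic_min_degree:
  fixes X0 V :: "quat poly"
  defines "S \<equiv> \<lambda>C. lead_coeff C = 1 \<and> X0 \<star> (dual_poly C + dual_poly C) + V \<star> primal_poly C = 0"
  assumes V: "V \<noteq> 0 \<Longrightarrow> degree V < degree X0" and "X0 \<noteq> 0" and "S C0"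
  shows "\<exists>!C. is_arg_min degree S C"
proof (rule ex_ex1I)
  show "\<exists>C. is_arg_min degree S C"
    using is_arg_min_arg_min_nat[of S, OF \<open>S C0\<close>] by blast
next
  fix C C' assume "is_arg_min degree S C" "is_arg_min degree S C'"
  then have S: "S C" "S C'" and min: "\<And>E. S E \<Longrightarrow> degree C \<le> degree E"
    and deg: "degree C = degree C'"
    by (auto simp: is_arg_min_linorder intro: antisym)
  show "C = C'"
  proof (rule ccontr)
    assume "C \<noteq> C'"
    define D where "D = C - C'"
    have proj: "primal_poly D = primal_poly C - primal_poly C'"
        "dual_poly D = dual_poly C - dual_poly C'"
      by (simp_all add: poly_eq_iff D_def)
    have "X0 \<star> (dual_poly D + dual_poly D) + V \<star> primal_poly D
        = (X0 \<star> (dual_poly C + dual_poly C) + V \<star> primal_poly C)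
          - (X0 \<star> (dual_poly C' + dual_poly C') + V \<star> primal_poly C')"
      by (simp add: proj fps_of_poly_hom algebra_simps flip: fps_of_poly_eq_iff)
    then have "X0 \<star> (dual_poly D + dual_poly D) + V \<star> primal_poly D = 0"
      using S by (simp add: S_def)
    moreover have "D \<noteq> 0" using \<open>C \<noteq> C'\<close> by (simp add: D_def)
    ultimately obtain E where "S E" "degree E \<le> degree D"
      using monic_multiple[OF _ V \<open>X0 \<noteq> 0\<close>, of D] unfolding S_def by blast
    \<comment> \<open>The leading terms cancel, as both polynomials are monic of the same degree.\<close>
    have "coeff D (degree C) = 0" using S deg by (simp add: S_def D_def)
    moreover have "degree D \<le> degree C"
      using deg degree_diff_le_max[of C C'] by (simp add: D_def)
    ultimately have "degree D < degree C"
      using \<open>D \<noteq> 0\<close> by (metis le_neq_implies_less leading_coeff_0_iff)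
    with min[OF \<open>S E\<close>] \<open>degree E \<le> degree D\<close> show False by simp
  qed
qed

theorem theorem2:
  fixes x0 x1 x2 x3 :: "real poly"
  assumes reduced: "degree (Gcd {x0, x1, x2, x3}) = 0"
    and at_infinity: "point_equiv (lead_coeff (quat_poly x0 x1 x2 x3)) 1"
  shows "\<exists>!C :: dquat poly. is_arg_min degree
           (\<lambda>C. motion_polynomial C \<and> lead_coeff C = 1 \<and>
              curve_equiv (origin_trajectory C) (quat_poly x0 x1 x2 x3)) C"
proof -
  define X0 :: "quat poly" where "X0 = map_poly of_real x0"
  define V where "V = quat_poly 0 x1 x2 x3"
  let ?X = "quat_poly x0 x1 x2 x3"
  define d where "d = degree ?X"
  have X: "?X = X0 + V"
    by (simp add: poly_eq_iff X0_def V_def coeff_quat_poly coeff_map_poly of_real_quat quat_ops)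
  have V: "qcnj_poly V = - V"
    by (simp add: poly_eq_iff V_def coeff_quat_poly qcnj_def quat_ops)
  obtain c where c: "c \<noteq> 0" "coeff ?X d = c *\<^sub>R 1"
    using at_infinity by (auto simp: point_equiv_def d_def)
  then have coeff: "coeff x0 d = c" "coeff V d = 0"
    by (simp_all add: coeff_quat_poly V_def quat_ops)
  have le: "degree x0 \<le> d" "degree V \<le> d"
    by (simp_all add: V_def d_def degree_quat_poly)
  have "x0 \<noteq> 0" using c coeff by auto
  have "degree x0 = d" using le coeff c by (metis le_antisym le_degree)
  have "degree X0 = d" using \<open>degree x0 = d\<close> by (simp add: X0_def degree_map_poly)
  have degV: "degree V < degree X0" if "V \<noteq> 0"
    using that coeff le \<open>degree X0 = d\<close> by (metis le_neq_implies_less leading_coeff_0_iff)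
  have "X0 \<noteq> 0" using \<open>x0 \<noteq> 0\<close> by (simp add: X0_def of_real_poly_eq_0_iff)
  define S where
    "S = (\<lambda>C. lead_coeff C = 1 \<and> X0 \<star> (dual_poly C + dual_poly C) + V \<star> primal_poly C = 0)"
  \<comment> \<open>The solution \<open>P = 2 x\<^sub>0\<close>, \<open>Q = - V\<close>: real polynomials commute with \<open>V\<close>.\<close>
  define C where "C = map_poly (\<lambda>p. DQuat (2 *\<^sub>R p) 0) X0 - map_poly (\<lambda>p. DQuat 0 p) V"
  have C: "primal_poly C = X0 + X0" "dual_poly C = - V"
    by (simp_all add: C_def poly_eq_iff coeff_map_poly dquat_ops scaleR_2)
  have "X0 \<star> (dual_poly C + dual_poly C) + V \<star> primal_poly C = 0"
    unfolding C
    by (simp add: X0_def fps_of_poly_hom algebra_simps fps_of_real_poly_central flip: fps_of_poly_eq_iff)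
  moreover have "C \<noteq> 0"
  proof
    assume "C = 0"
    then have "X0 + X0 = 0" using C(1) by simp
    then show False using \<open>X0 \<noteq> 0\<close> by (auto simp: poly_eq_iff quat_eq_iff quat_ops)
  qed
  ultimately obtain E where "S E"
    using monic_multiple[OF _ degV \<open>X0 \<noteq> 0\<close>] unfolding S_def by blast
  have "\<exists>!C. is_arg_min degree S C"
    using ex1_monic_min_degree[OF degV \<open>X0 \<noteq> 0\<close>] \<open>S E\<close> unfolding S_def by blast
  moreover have "S = (\<lambda>C. motion_polynomial C \<and> lead_coeff C = 1 \<and>
      curve_equiv (origin_trajectory C) ?X)"
    unfolding S_def X X0_def using trajectory_iff[OF _ \<open>x0 \<noteq> 0\<close> V] by blast
  ultimately show ?thesis by simp
qed

end
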